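(* Let $G=(V,E,\Gamma)$ be a finite connected simple weighted graph with $N=|V|$ vertices and nonzero edge weights, such that for every edge $e$ there is a spanning tree of $G$ not containing $e$. Let $\omega\in\mathbb{R}^V$ be a vector of natural frequencies, let $\mathcal{I}=\{I_e\}_{e\in E}$ be sets of real numbers such that $\sin$ restricted to each $I_e$ is injective, and let $v_1,\dots,v_c$ be a cycle basis of $G$. With $W$ and $A$ as defined in the context, there is a one-to-one correspondence between the fixed points $\theta$ (considered modulo $2\pi$ in each coordinate and up to a common translation of all coordinates) of $$\frac{d\theta_i}{dt}=\omega_i-\sum_{j=1}^N\gamma_{ij}\sin(\theta_i-\theta_j),\qquad i\in\{1,\dots,N\},$$ satisfying $\theta_e\in I_e+2\pi\mathbb{Z}$ for every $e\in E$, and the lattice points in $W(A)$, i.e. the elements of $W(A)\cap\mathbb{Z}^c$.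
   Context: The coupling $\gamma_{ij}=\gamma_{ji}$ equals the weight $\gamma_e$ if $e$ is the edge joining $i$ and $j$, and $0$ if $i,j$ are not adjacent. Fix an ordering and an orientation of the edges. The incidence matrix $B:\mathbb{R}^E\to\mathbb{R}^V$ has $B_{ie}=1$ if $i$ is the head of $e$, $B_{ie}=-1$ if $i$ is the tail of $e$, and $B_{ie}=0$ otherwise. For an edge $e$ with head $i$ and tail $j$, the angle difference is $\theta_e=\theta_i-\theta_j$, so $\theta_e=(B^\top\theta)_e$. The cycle space is the additive group of integral vectors in $\ker B$; a cycle basis $v_1,\dots,v_c$ is a $\mathbb{Z}$-basis of it, and $c=|E|-|V|+1$. $D_\gamma$ is the diagonal matrix with diagonal entries $\gamma_e$, $e\in E$. $B^{-1}$ denotes the pseudoinverse of $B$. $\sin_\mathcal{I}$ is the componentwise sine function restricted to $\prod_{e\in E}I_e$, with inverse $\sin_\mathcal{I}^{-1}$ (the $e$-component is the inverse of $\sin|_{I_e}$, defined on $\sin(I_e)$). For $\alpha\in\mathbb{R}^c$ define $$L(\alpha)=D_\gamma^{-1}B^{-1}\omega+\sum_{i=1}^c\alpha_iD_\gamma^{-1}v_i,\qquad W(\alpha)=\frac1{2\pi}\left(\langle v_1,\sin_\mathcal{I}^{-1}L(\alpha)\rangle,\dots,\langle v_c,\sin_\mathcal{I}^{-1}L(\alpha)\rangle\right).$$ $A\subseteq\mathbb{R}^c$ is the set of $\alpha$ for which $\sin_\mathcal{I}^{-1}L(\alpha)$ is well-defined, i.e. $L(\alpha)_e\in\sin(I_e)$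 for all $e\in E$.
   Formalization: Fixed points are taken modulo common rotation (all velocities equal; literal fixed points if the frequencies sum to 0), and they correspond to the α in A with W(α) integral; the correspondence with lattice points of W(A) is claimed only when W is injective on these α. *)

theory Defs
  imports Complex_Main "Graph_Theory.Digraph_Component" "Jordan_Normal_Form.Matrix"
begin

section \<open>Graphs\<close>

text \<open>
  A simple graph with a chosen orientation of its edges is a digraph without loops in which
  distinct arcs have distinct \<^emph>\<open>unordered\<close> pairs of end points. The library constant
  \<^const>\<open>Digraph_Component.connected\<close> ignores the orientation.
\<close>

definition oriented_simple_graph :: "('a, 'b) pre_digraph \<Rightarrow> bool" where
  "oriented_simple_graph G \<longleftrightarrow>
     fin_digraph G \<and> loopfree_digraph G \<and> inj_on (\<lambda>e. {tail G e, head G e}) (arcs G)"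

text \<open>
  The vertices are numbered \<open>0, \<dots>, |V| - 1\<close> and the edges \<open>0, \<dots>, |E| - 1\<close>, so that
  \<open>\<real>\<^sup>V\<close> and \<open>\<real>\<^sup>E\<close> are the carriers of vectors of dimension \<open>|V|\<close> and \<open>|E|\<close>.
\<close>

definition numbered :: "(nat, nat) pre_digraph \<Rightarrow> bool" where
  "numbered G \<longleftrightarrow> verts G = {..<card (verts G)} \<and> arcs G = {..<card (arcs G)}"

text \<open>
  The library constant \<^const>\<open>tree\<close> only excludes \<^emph>\<open>directed\<close> cycles. Here cycles are taken in the
  underlying undirected graph, where the closed walks \<open>a, b, a\<close> of length 2 do not count.
\<close>

definition undirected_tree :: "('a, 'b) pre_digraph \<Rightarrow> bool" where
  "undirected_tree T \<longleftrightarrow>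
     Digraph_Component.connected T \<and> (\<nexists>p. pre_digraph.cycle (with_proj (mk_symmetric T)) p \<and> length p \<ge> 3)"

definition undirected_spanning_tree :: "('a, 'b) pre_digraph \<Rightarrow> ('a, 'b) pre_digraph \<Rightarrow> bool" where
  "undirected_spanning_tree T G \<longleftrightarrow> undirected_tree T \<and> spanning T G"

definition incidence_matrix :: "(nat, nat) pre_digraph \<Rightarrow> real mat" where
  "incidence_matrix G = mat (card (verts G)) (card (arcs G))
     (\<lambda>(i, e). if i = head G e then 1 else if i = tail G e then - 1 else 0)"

section \<open>Integral vectors and cycle bases\<close>

definition integral_vectors :: "nat \<Rightarrow> real vec set" where
  "integral_vectors n = {x \<in> carrier_vec n. \<forall>i<n. x $ i \<in> \<int>}"

definition cycle_space :: "(nat, nat) pre_digraph \<Rightarrow> real vec set" where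
  "cycle_space G = {x \<in> integral_vectors (card (arcs G)).
     incidence_matrix G *\<^sub>v x = 0\<^sub>v (card (verts G))}"

definition cycle_basis :: "(nat, nat) pre_digraph \<Rightarrow> real vec list \<Rightarrow> bool" where
  "cycle_basis G vs \<longleftrightarrow> set vs \<subseteq> cycle_space G \<and>
     (\<forall>x \<in> cycle_space G. \<exists>!k :: int vec. k \<in> carrier_vec (length vs) \<and>
        x = finsum_vec TYPE(real) (card (arcs G)) (\<lambda>i. of_int (k $ i) \<cdot>\<^sub>v vs ! i) {..<length vs})"

section \<open>Pseudoinverse\<close>

text \<open>The Penrose conditions determine the pseudoinverse of a real matrix uniquely.\<close>

definition is_pseudoinverse :: "real mat \<Rightarrow> real mat \<Rightarrow> bool" where
  "is_pseudoinverse M X \<longleftrightarrow> X \<in> carrier_mat (dim_col M) (dim_row M) \<and>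
     M * X * M = M \<and> X * M * X = X \<and>
     transpose_mat (M * X) = M * X \<and> transpose_mat (X * M) = X * M"

definition pseudoinverse :: "real mat \<Rightarrow> real mat" where
  "pseudoinverse M = (THE X. is_pseudoinverse M X)"

section \<open>The Kuramoto system\<close>

definition coupling :: "(nat, nat) pre_digraph \<Rightarrow> (nat \<Rightarrow> real) \<Rightarrow> nat \<Rightarrow> nat \<Rightarrow> real" where
  "coupling G \<gamma> i j =
     (if \<exists>e\<in>arcs G. {tail G e, head G e} = {i, j}
      then \<gamma> (THE e. e \<in> arcs G \<and> {tail G e, head G e} = {i, j}) else 0)"

definition velocity ::
  "(nat, nat) pre_digraph \<Rightarrow> (nat \<Rightarrow> real) \<Rightarrow> real vec \<Rightarrow> real vec \<Rightarrow> nat \<Rightarrow> real" where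
  "velocity G \<gamma> \<omega> \<theta> i =
     \<omega> $ i - (\<Sum>j<card (verts G). coupling G \<gamma> i j * sin (\<theta> $ i - \<theta> $ j))"

definition fixed_points ::
  "(nat, nat) pre_digraph \<Rightarrow> (nat \<Rightarrow> real) \<Rightarrow> real vec \<Rightarrow> real vec set" where
  "fixed_points G \<gamma> \<omega> =
     {\<theta> \<in> carrier_vec (card (verts G)). \<forall>i<card (verts G). velocity G \<gamma> \<omega> \<theta> i = 0}"

text \<open>
  Fixed points up to a common translation: the fixed points of the flow that the system induces on
  the quotient of the torus by common translations, i.e. all coordinates move with one velocity.
  That velocity is the mean of the natural frequencies. So these are the fixed points in the usual
  sense when the frequencies sum to 0; otherwise the system has none in the usual sense.
\<close>

definition relative_fixed_points ::
  "(nat, nat) pre_digraph \<Rightarrow> (nat \<Rightarrow> real) \<Rightarrow> real vec \<Rightarrow> real vec set" where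
  "relative_fixed_points G \<gamma> \<omega> =
     {\<theta> \<in> carrier_vec (card (verts G)). \<exists>u. \<forall>i<card (verts G). velocity G \<gamma> \<omega> \<theta> i = u}"

definition angle_difference :: "(nat, nat) pre_digraph \<Rightarrow> real vec \<Rightarrow> nat \<Rightarrow> real" where
  "angle_difference G \<theta> e = \<theta> $ head G e - \<theta> $ tail G e"

definition admissible_states :: "(nat, nat) pre_digraph \<Rightarrow> (nat \<Rightarrow> real set) \<Rightarrow> real vec set" where
  "admissible_states G I = {\<theta> \<in> carrier_vec (card (verts G)).
     \<forall>e\<in>arcs G. \<exists>x\<in>I e. \<exists>k::int. angle_difference G \<theta> e = x + 2 * pi * of_int k}"

definition angle_equiv :: "(nat, nat) pre_digraph \<Rightarrow> (real vec \<times> real vec) set" where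
  "angle_equiv G = {(\<theta>, \<phi>). \<theta> \<in> carrier_vec (card (verts G)) \<and> \<phi> \<in> carrier_vec (card (verts G)) \<and>
     (\<exists>t. \<forall>i<card (verts G). \<exists>k::int. \<phi> $ i = \<theta> $ i + t + 2 * pi * of_int k)}"

section \<open>The maps \<open>L\<close> and \<open>W\<close>\<close>

definition L_map ::
  "(nat, nat) pre_digraph \<Rightarrow> (nat \<Rightarrow> real) \<Rightarrow> real vec \<Rightarrow> real vec list \<Rightarrow> real vec \<Rightarrow> real vec" where
  "L_map G \<gamma> \<omega> vs \<alpha> =
     (let m = card (arcs G); D_inv = mat_diag m (\<lambda>e. inverse (\<gamma> e))
      in D_inv *\<^sub>v (pseudoinverse (incidence_matrix G) *\<^sub>v \<omega>)
         + finsum_vec TYPE(real) m (\<lambda>i. \<alpha> $ i \<cdot>\<^sub>v (D_inv *\<^sub>v vs ! i)) {..<length vs})"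

definition A_set ::
  "(nat, nat) pre_digraph \<Rightarrow> (nat \<Rightarrow> real) \<Rightarrow> real vec \<Rightarrow> (nat \<Rightarrow> real set) \<Rightarrow> real vec list
     \<Rightarrow> real vec set" where
  "A_set G \<gamma> \<omega> I vs =
     {\<alpha> \<in> carrier_vec (length vs). \<forall>e\<in>arcs G. L_map G \<gamma> \<omega> vs \<alpha> $ e \<in> sin ` I e}"

definition sin_inverse ::
  "(nat, nat) pre_digraph \<Rightarrow> (nat \<Rightarrow> real set) \<Rightarrow> real vec \<Rightarrow> real vec" where
  "sin_inverse G I y = vec (card (arcs G)) (\<lambda>e. the_inv_into (I e) sin (y $ e))"

text \<open>
  \<open>W\<close> need not be injective: on a cyclically oriented 4-cycle with unit weights, zero frequencies and
  \<open>I\<close> equal to \<open>[-\<pi>/2, \<pi>/2]\<close> on two edges and \<open>[\<pi>/2, 3\<pi>/2]\<close> on the other two, it is constantly 1,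
  while there is a continuum of fixed points. A lattice point of \<open>W(A)\<close> therefore has to be counted
  once for each parameter in \<open>A\<close> that is mapped to it.
\<close>

definition W_map ::
  "(nat, nat) pre_digraph \<Rightarrow> (nat \<Rightarrow> real) \<Rightarrow> real vec \<Rightarrow> (nat \<Rightarrow> real set) \<Rightarrow> real vec list
     \<Rightarrow> real vec \<Rightarrow> real vec" where
  "W_map G \<gamma> \<omega> I vs \<alpha> =
     vec (length vs) (\<lambda>i. 1 / (2 * pi) * (vs ! i \<bullet> sin_inverse G I (L_map G \<gamma> \<omega> vs \<alpha>)))"

end

theory Submission
  imports Defs "Jordan_Normal_Form.Determinant"
begin

text \<open>
  Sending a state \<open>\<theta>\<close> to the coordinates of \<open>D\<^sub>\<gamma> sin (B\<^sup>T \<theta>) - B\<^sup>-\<^sup>1 \<omega>\<close> in the cycle basis is the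
  required correspondence: this vector lies in the kernel of \<open>B\<close> exactly when all velocities agree,
  since \<open>B B\<^sup>-\<^sup>1\<close> subtracts the mean. Integrality of \<open>W\<close> says that the phases recovered by the inverse
  sine sum to a multiple of \<open>2 \<pi>\<close> around every cycle, so they integrate along walks to angles modulo
  \<open>2 \<pi>\<close>. Let \<open>p\<^sub>i\<close> be the integral edge vector of a walk from vertex 0 to \<open>i\<close>. The cycles
  \<open>1\<^sub>e - p\<^sub>h + p\<^sub>t\<close>, for edges \<open>e\<close> with head \<open>h\<close> and tail \<open>t\<close>, span the real kernel of \<open>B\<close>, so a
  \<open>\<int>\<close>-basis of the cycle space is an \<open>\<real>\<close>-basis of that kernel.
\<close>

section \<open>Integer multiples of 2 pi\<close>

definition angle_lattice :: "real set" where
  "angle_lattice = range (\<lambda>k::int. 2 * pi * of_int k)"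

lemma angle_lattice_of_int [simp]: "2 * pi * of_int k \<in> angle_lattice"
  by (simp add: angle_lattice_def)

lemma angle_lattice_add: "x \<in> angle_lattice \<Longrightarrow> y \<in> angle_lattice \<Longrightarrow> x + y \<in> angle_lattice"
  unfolding angle_lattice_def by (auto simp: image_iff simp flip: of_int_add distrib_left)

lemma angle_lattice_mult_Ints: "a \<in> \<int> \<Longrightarrow> x \<in> angle_lattice \<Longrightarrow> a * x \<in> angle_lattice"
  unfolding angle_lattice_def
  by (auto elim!: Ints_cases simp: image_iff mult.left_commute[of _ "2 * pi"] simp flip: of_int_mult)

lemma angle_lattice_uminus_iff [simp]: "- x \<in> angle_lattice \<longleftrightarrow> x \<in> angle_lattice"
  using angle_lattice_mult_Ints[of "-1" x] angle_lattice_mult_Ints[of "-1" "- x"] by auto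

lemma angle_lattice_diff: "x \<in> angle_lattice \<Longrightarrow> y \<in> angle_lattice \<Longrightarrow> x - y \<in> angle_lattice"
  using angle_lattice_add[of x "- y"] by simp

lemma angle_lattice_sum: "(\<And>i. i \<in> S \<Longrightarrow> f i \<in> angle_lattice) \<Longrightarrow> sum f S \<in> angle_lattice"
proof (induction S rule: infinite_finite_induct)
  case (insert i S)
  then show ?case by (simp add: angle_lattice_add)
qed (use angle_lattice_of_int[of 0] in auto)

lemma sin_cong_angle_lattice:
  assumes "x - y \<in> angle_lattice" shows "sin x = sin y"
proof -
  from assms obtain k :: int where "x = y + 2 * pi * of_int k"
    unfolding angle_lattice_def by (auto simp: diff_eq_eq add.commute)
  then show ?thesis
    using sin_cos_eq_iff[of x y] by (metis mult.assoc mult.commute)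
qed

section \<open>Indicator sums and bijections on quotients\<close>

lemma sum_mult_of_bool_eq:
  fixes g :: "nat \<Rightarrow> real"
  assumes "i < k" shows "(\<Sum>j<k. g j * of_bool (j = i)) = g i" and "(\<Sum>j<k. g j * of_bool (i = j)) = g i"
  using assms by (simp_all add: of_bool_def if_distrib cong: if_cong)

text \<open>Choosing a representative of each class turns a map whose fibres in \<open>S\<close> are
  traced out by \<open>R\<close> into a bijection on the quotient. Since \<open>S\<close> is not
  assumed to be a union of classes, the representative has to be sought inside
  \<open>S\<close>.\<close>

lemma bij_betw_quotient:
  assumes "equiv X R" "S \<subseteq> X" "g ` S = T"
    and "\<And>x y. x \<in> S \<Longrightarrow> y \<in> S \<Longrightarrow> g x = g y \<longleftrightarrow> (x, y) \<in> R"
  shows "\<exists>\<Phi>. bij_betw \<Phi> (S // R) T"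
proof -
  define rep where "rep C = (SOME x. x \<in> S \<and> R `` {x} = C)" for C
  have rep: "rep (R `` {x}) \<in> S" "g (rep (R `` {x})) = g x" if "x \<in> S" for x
  proof -
    have "rep (R `` {x}) \<in> S \<and> R `` {rep (R `` {x})} = R `` {x}"
      unfolding rep_def by (rule someI[of _ x]) (use that in auto)
    then show "rep (R `` {x}) \<in> S" "g (rep (R `` {x})) = g x"
      using assms that eq_equiv_class_iff[OF assms(1)] by blast+
  qed
  have "bij_betw (g \<circ> rep) (S // R) T"
  proof (rule bij_betwI')
    show "(g \<circ> rep) C = (g \<circ> rep) D \<longleftrightarrow> C = D" if "C \<in> S // R" "D \<in> S // R" for C D
    proof -
      obtain x y where xy: "x \<in> S" "y \<in> S" "C = R `` {x}" "D = R `` {y}"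
        using \<open>C \<in> S // R\<close> \<open>D \<in> S // R\<close> by (auto elim!: quotientE)
      have "C = D \<longleftrightarrow> (x, y) \<in> R"
        unfolding xy using xy(1,2) assms(2) by (intro eq_equiv_class_iff[OF assms(1)]) auto
      also have "\<dots> \<longleftrightarrow> g (rep C) = g (rep D)"
        using xy rep(2) assms(4) by metis
      finally show ?thesis by auto
    qed
    show "(g \<circ> rep) C \<in> T" if "C \<in> S // R" for C
      using that rep assms(3) by (auto elim!: quotientE)
    show "\<exists>C\<in>S // R. t = (g \<circ> rep) C" if t: "t \<in> T" for t
    proof -
      obtain x where "x \<in> S" "t = g x" using t unfolding assms(3)[symmetric] by blast
      then show ?thesis using rep(2) quotientI[of x S R] by (intro bexI[of _ "R `` {x}"]) auto
    qed
  qed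
  then show ?thesis by blast
qed

section \<open>States modulo 2 pi and common translations\<close>

lemma angle_equiv_iff:
  "(\<theta>, \<phi>) \<in> angle_equiv G \<longleftrightarrow>
    \<theta> \<in> carrier_vec (card (verts G)) \<and> \<phi> \<in> carrier_vec (card (verts G)) \<and>
    (\<exists>t. \<forall>i<card (verts G). \<phi> $ i - \<theta> $ i - t \<in> angle_lattice)"
  unfolding angle_equiv_def angle_lattice_def by (auto simp: image_iff algebra_simps)

lemma equiv_angle_equiv: "equiv (carrier_vec (card (verts G))) (angle_equiv G)"
proof (rule equivI)
  show "angle_equiv G \<subseteq> carrier_vec (card (verts G)) \<times> carrier_vec (card (verts G))"
    by (auto simp: angle_equiv_iff)
  show "refl_on (carrier_vec (card (verts G))) (angle_equiv G)"
  proof (rule refl_onI)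
    show "(\<theta>, \<theta>) \<in> angle_equiv G" if "\<theta> \<in> carrier_vec (card (verts G))" for \<theta>
      unfolding angle_equiv_iff using that angle_lattice_of_int[of 0] by (auto intro!: exI[of _ 0])
  qed
  show "sym (angle_equiv G)"
  proof (rule symI)
    fix \<theta> \<phi> assume "(\<theta>, \<phi>) \<in> angle_equiv G"
    then obtain t where c: "\<theta> \<in> carrier_vec (card (verts G))" "\<phi> \<in> carrier_vec (card (verts G))"
      and t: "\<And>i. i < card (verts G) \<Longrightarrow> \<phi> $ i - \<theta> $ i - t \<in> angle_lattice"
      by (auto simp: angle_equiv_iff)
    have "\<theta> $ i - \<phi> $ i - (- t) \<in> angle_lattice" if "i < card (verts G)" for i
      using t[OF that] angle_lattice_uminus_iff[of "\<phi> $ i - \<theta> $ i - t"] by (simp add: algebra_simps)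
    then show "(\<phi>, \<theta>) \<in> angle_equiv G" using c unfolding angle_equiv_iff by blast
  qed
  show "trans (angle_equiv G)"
  proof (rule transI)
    fix \<theta> \<phi> \<psi> assume "(\<theta>, \<phi>) \<in> angle_equiv G" "(\<phi>, \<psi>) \<in> angle_equiv G"
    then obtain s t where c: "\<theta> \<in> carrier_vec (card (verts G))" "\<psi> \<in> carrier_vec (card (verts G))"
      and s: "\<And>i. i < card (verts G) \<Longrightarrow> \<phi> $ i - \<theta> $ i - s \<in> angle_lattice"
      and t: "\<And>i. i < card (verts G) \<Longrightarrow> \<psi> $ i - \<phi> $ i - t \<in> angle_lattice"
      by (auto simp: angle_equiv_iff)
    have "\<psi> $ i - \<theta> $ i - (s + t) \<in> angle_lattice" if "i < card (verts G)" for i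
      using angle_lattice_add[OF s[OF that] t[OF that]] by (simp add: algebra_simps)
    then show "(\<theta>, \<psi>) \<in> angle_equiv G" using c by (auto simp: angle_equiv_iff)
  qed
qed

section \<open>Diagonal matrices and uniqueness of the pseudoinverse\<close>

lemma mat_diag_mult_vec:
  fixes x :: "'a :: semiring_1 vec"
  assumes "x \<in> carrier_vec k"
  shows "mat_diag k f *\<^sub>v x = vec k (\<lambda>i. f i * x $ i)"
proof (rule eq_vecI)
  fix i assume "i < dim_vec (vec k (\<lambda>i. f i * x $ i))"
  then have i: "i < k" by simp
  have "(mat_diag k f *\<^sub>v x) $ i = (\<Sum>j<k. (if i = j then f j else 0) * x $ j)"
    using i assms by (auto simp: mat_diag_def scalar_prod_def lessThan_atLeast0 intro!: sum.cong)
  also have "\<dots> = f i * x $ i" using i by (simp add: if_distrib[of "\<lambda>t. t * _"] cong: if_cong)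
  finally show "(mat_diag k f *\<^sub>v x) $ i = vec k (\<lambda>i. f i * x $ i) $ i" using i by simp
qed (simp add: mat_diag_def)

text \<open>Penrose's argument: the symmetry conditions force \<open>M * X = M * Y\<close> and
  \<open>X * M = Y * M\<close>, and then
  \<open>X = X * M * X = X * M * Y = Y * M * Y = Y\<close>.\<close>

lemma pseudoinverse_unique:
  assumes "is_pseudoinverse M X" "is_pseudoinverse M Y" shows "X = Y"
proof -
  define r c where "r = dim_row M" and "c = dim_col M"
  have M: "M \<in> carrier_mat r c" by (simp add: r_def c_def)
  have X: "X \<in> carrier_mat c r" "M * X * M = M" "X * M * X = X"
      "transpose_mat (M * X) = M * X" "transpose_mat (X * M) = X * M"
    and Y: "Y \<in> carrier_mat c r" "M * Y * M = M" "Y * M * Y = Y"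
      "transpose_mat (M * Y) = M * Y" "transpose_mat (Y * M) = Y * M"
    using assms by (auto simp: is_pseudoinverse_def r_def c_def)
  have MX: "M * X \<in> carrier_mat r r" and MY: "M * Y \<in> carrier_mat r r"
    and XM: "X * M \<in> carrier_mat c c" and YM: "Y * M \<in> carrier_mat c c"
    using M X(1) Y(1) by auto
  have eq1: "M * X = M * Y"
  proof -
    have "M * X = M * Y * M * X" using Y(2) by simp
    also have "\<dots> = M * Y * (M * X)" by (rule assoc_mult_mat[OF MY M X(1)])
    \<comment> \<open>Both factors are symmetric, so their product is the transpose of the product
      in reverse order. There \<open>M * X * M\<close> collapses to \<open>M\<close>.\<close>
    also have "\<dots> = transpose_mat (M * X * (M * Y))"
      using transpose_mult[OF MX MY] X(4) Y(4) by simp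
    also have "M * X * (M * Y) = M * X * M * Y" by (rule assoc_mult_mat[OF MX M Y(1), symmetric])
    finally show ?thesis using X(2) Y(4) by simp
  qed
  have eq2: "X * M = Y * M"
  proof -
    have "X * M = X * (M * Y * M)" using Y(2) by simp
    also have "\<dots> = X * (M * (Y * M))" using assoc_mult_mat[OF M Y(1) M] by simp
    also have "\<dots> = X * M * (Y * M)" by (rule assoc_mult_mat[OF X(1) M YM, symmetric])
    also have "\<dots> = transpose_mat (Y * M * (X * M))"
      using transpose_mult[OF YM XM] X(5) Y(5) by simp
    also have "Y * M * (X * M) = Y * (M * (X * M))" by (rule assoc_mult_mat[OF Y(1) M XM])
    also have "M * (X * M) = M" using assoc_mult_mat[OF M X(1) M] X(2) by simp
    finally show ?thesis using Y(5) by simp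
  qed
  have "X = X * (M * X)" using X(3) assoc_mult_mat[OF X(1) M X(1)] by simp
  also have "\<dots> = X * M * Y" unfolding eq1 by (rule assoc_mult_mat[OF X(1) M Y(1), symmetric])
  also have "\<dots> = Y" unfolding eq2 by (rule Y(3))
  finally show ?thesis .
qed

section \<open>The incidence matrix of a connected graph\<close>

locale connected_network =
  fixes G :: "(nat, nat) pre_digraph"
  assumes simple: "oriented_simple_graph G"
    and numbered: "numbered G"
    and connected: "Digraph_Component.connected G"
begin

abbreviation n :: nat where "n \<equiv> card (verts G)"
abbreviation m :: nat where "m \<equiv> card (arcs G)"
abbreviation B :: "real mat" where "B \<equiv> incidence_matrix G"

lemma arcs_conv: "e \<in> arcs G \<longleftrightarrow> e < m"
  using numbered unfolding numbered_def by auto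

lemma verts_conv: "v \<in> verts G \<longleftrightarrow> v < n"
  using numbered unfolding numbered_def by auto

lemma head_less: "e < m \<Longrightarrow> head G e < n" and tail_less: "e < m \<Longrightarrow> tail G e < n"
  and tail_neq_head: "e < m \<Longrightarrow> tail G e \<noteq> head G e"
proof -
  interpret loopfree_digraph G using simple unfolding oriented_simple_graph_def by auto
  show "e < m \<Longrightarrow> head G e < n" "e < m \<Longrightarrow> tail G e < n" "e < m \<Longrightarrow> tail G e \<noteq> head G e"
    using head_in_verts tail_in_verts no_loops by (auto simp: arcs_conv verts_conv)
qed

lemma arc_eqI:
  "e < m \<Longrightarrow> f < m \<Longrightarrow> {tail G e, head G e} = {tail G f, head G f} \<Longrightarrow> e = f"
  using simple unfolding oriented_simple_graph_def
  by (auto simp: arcs_conv dest: inj_onD)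

lemma n_pos: "0 < n"
  using connected verts_conv unfolding Digraph_Component.connected_def strongly_connected_def
  by (metis bot_nat_0.not_eq_extremum ex_in_conv not_less0 pverts_mk_symmetric with_proj_simps(1))

lemma B_carrier [simp]: "B \<in> carrier_mat n m"
  by (simp add: incidence_matrix_def)

text \<open>The two indicators never overlap because there are no loops. In this form sums against
  \<open>B\<close> split into a head part and a tail part.\<close>

lemma B_index:
  "i < n \<Longrightarrow> e < m \<Longrightarrow> B $$ (i, e) = of_bool (i = head G e) - of_bool (i = tail G e)"
  using tail_neq_head by (auto simp: incidence_matrix_def)

lemma B_mult_vec_index:
  assumes "x \<in> carrier_vec m" "i < n" shows "(B *\<^sub>v x) $ i = (\<Sum>e<m. B $$ (i, e) * x $ e)"
  using assms carrier_matD[OF B_carrier]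
  by (auto simp: scalar_prod_def lessThan_atLeast0 intro!: sum.cong)

lemma sum_mult_B:
  assumes "e < m" shows "(\<Sum>i<n. f i * B $$ (i, e)) = f (head G e) - f (tail G e)"
proof -
  have "(\<Sum>i<n. f i * B $$ (i, e)) =
      (\<Sum>i<n. (if i = head G e then f i else 0) - (if i = tail G e then f i else 0))"
    using assms by (intro sum.cong) (auto simp: B_index)
  also have "\<dots> = f (head G e) - f (tail G e)"
    using head_less[OF assms] tail_less[OF assms] by (simp add: sum_subtractf)
  finally show ?thesis .
qed

lemma sum_B_column: "e < m \<Longrightarrow> (\<Sum>i<n. B $$ (i, e)) = 0"
  using sum_mult_B[of e "\<lambda>_. 1"] by simp

text \<open>Discrete integration by parts: the transpose of \<open>B\<close> takes a potential to
  its edge differences. In particular the kernel of \<open>B\<close> is orthogonal to all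
  gradients.\<close>

lemma sum_mult_gradient:
  "(\<Sum>e<m. z e * (f (head G e) - f (tail G e))) = (\<Sum>i<n. f i * (\<Sum>e<m. B $$ (i, e) * z e))"
proof -
  have "z e * (f (head G e) - f (tail G e)) = (\<Sum>i<n. f i * (B $$ (i, e) * z e))" if "e < m" for e
    unfolding sum_mult_B[OF that, symmetric] sum_distrib_left by (simp add: mult_ac)
  then have "(\<Sum>e<m. z e * (f (head G e) - f (tail G e))) = (\<Sum>e<m. \<Sum>i<n. f i * (B $$ (i, e) * z e))"
    by simp
  also have "\<dots> = (\<Sum>i<n. f i * (\<Sum>e<m. B $$ (i, e) * z e))"
    by (subst sum.swap) (simp add: sum_distrib_left)
  finally show ?thesis .
qed

section \<open>Walks from vertex 0 and the cycles they close\<close>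

lemma ex_walk_vector:
  assumes "v < n"
  shows "\<exists>p. (\<forall>e. p e \<in> \<int>) \<and>
    (\<forall>i<n. (\<Sum>e<m. B $$ (i, e) * p e) = of_bool (i = v) - of_bool (i = 0))"
proof -
  have "0 \<rightarrow>\<^sup>*\<^bsub>with_proj (mk_symmetric G)\<^esub> v"
    using connected assms n_pos
    unfolding Digraph_Component.connected_def strongly_connected_def by (auto simp: verts_conv)
  then have "(0, v) \<in> rtrancl_on (verts G) (parcs (mk_symmetric G))"
    unfolding reachable_def by simp
  then show ?thesis
  proof (induction v rule: rtrancl_on_induct)
    case base
    show ?case by (rule exI[of _ "\<lambda>_. 0"]) simp
  next
    case (step y z)
    then obtain p where p: "\<And>e. p e \<in> \<int>"
      "\<And>i. i < n \<Longrightarrow> (\<Sum>e<m. B $$ (i, e) * p e) = of_bool (i = y) - of_bool (i = 0)" by blast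
    from step obtain f where f: "f < m"
      and ends: "(y, z) = (tail G f, head G f) \<or> (y, z) = (head G f, tail G f)"
      by (auto simp: parcs_mk_symmetric arcs_conv)
    \<comment> \<open>The sign records whether the step from \<open>y\<close> to \<open>z\<close>
      follows the orientation of \<open>f\<close>. Adding \<open>s\<close> times \<open>f\<close>
      therefore moves the end of the walk from \<open>y\<close> to \<open>z\<close>.\<close>
    define s :: real where "s = (if z = head G f then 1 else - 1)"
    define q where "q e = p e + s * of_bool (e = f)" for e
    have "(\<Sum>e<m. B $$ (i, e) * q e) = of_bool (i = z) - of_bool (i = 0)" if "i < n" for i
    proof -
      have "(\<Sum>e<m. B $$ (i, e) * q e) = (\<Sum>e<m. B $$ (i, e) * p e) + B $$ (i, f) * s"
        using sum_mult_of_bool_eq(1)[OF f, of "\<lambda>e. B $$ (i, e) * s"]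
        by (simp add: q_def distrib_left sum.distrib mult.assoc)
      then show ?thesis
        using ends p(2)[OF that] B_index[OF that f] tail_neq_head[OF f] by (auto simp: s_def)
    qed
    moreover have "q e \<in> \<int>" for e using p(1) by (simp add: q_def s_def)
    ultimately show ?case by blast
  qed
qed

text \<open>Any integral chain with boundary \<open>v\<close> minus 0 serves. The choices for
  different vertices are unrelated, and the one for vertex 0 may be a nonzero cycle.\<close>

definition walk_vector :: "nat \<Rightarrow> nat \<Rightarrow> real" where
  "walk_vector v = (SOME p. (\<forall>e. p e \<in> \<int>) \<and>
    (\<forall>i<n. (\<Sum>e<m. B $$ (i, e) * p e) = of_bool (i = v) - of_bool (i = 0)))"

lemma walk_vector_Ints: "v < n \<Longrightarrow> walk_vector v e \<in> \<int>"
  and B_walk_vector: "v < n \<Longrightarrow> i < n \<Longrightarrow>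
    (\<Sum>e<m. B $$ (i, e) * walk_vector v e) = of_bool (i = v) - of_bool (i = 0)"
  using someI_ex[OF ex_walk_vector, of v] unfolding walk_vector_def by blast+

text \<open>Edge differences telescope along a walk. Integration by parts reduces this to the
  boundary of the chain.\<close>

lemma sum_walk_vector:
  assumes "v < n"
  shows "(\<Sum>e<m. walk_vector v e * (f (head G e) - f (tail G e))) = f v - f 0"
proof -
  have "(\<Sum>e<m. walk_vector v e * (f (head G e) - f (tail G e)))
      = (\<Sum>i<n. f i * (\<Sum>e<m. B $$ (i, e) * walk_vector v e))"
    by (rule sum_mult_gradient)
  also have "\<dots> = (\<Sum>i<n. (if i = v then f i else 0) - (if i = 0 then f i else 0))"
    by (intro sum.cong) (auto simp: B_walk_vector[OF assms])
  also have "\<dots> = f v - f 0"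
    using assms n_pos by (simp add: sum_subtractf)
  finally show ?thesis .
qed

text \<open>The closed walk that runs along \<open>e\<close> from tail to head, back to vertex 0,
  and from there to the tail.\<close>

definition cycle_vector :: "nat \<Rightarrow> nat \<Rightarrow> real" where
  "cycle_vector e f =
     of_bool (f = e) - walk_vector (head G e) f + walk_vector (tail G e) f"

lemma cycle_vector_in_cycle_space: "e < m \<Longrightarrow> vec m (cycle_vector e) \<in> cycle_space G"
proof -
  assume e: "e < m"
  have "(\<Sum>f<m. B $$ (i, f) * cycle_vector e f) = 0" if i: "i < n" for i
  proof -
    have "(\<Sum>f<m. B $$ (i, f) * cycle_vector e f) = B $$ (i, e)
        - (\<Sum>f<m. B $$ (i, f) * walk_vector (head G e) f)
        + (\<Sum>f<m. B $$ (i, f) * walk_vector (tail G e) f)"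
      using sum_mult_of_bool_eq(1)[OF e, of "\<lambda>f. B $$ (i, f)"]
      by (simp add: cycle_vector_def distrib_left right_diff_distrib sum.distrib sum_subtractf)
    then show ?thesis
      unfolding B_walk_vector[OF head_less[OF e] i] B_walk_vector[OF tail_less[OF e] i] B_index[OF i e]
      by simp
  qed
  then have "B *\<^sub>v vec m (cycle_vector e) = 0\<^sub>v n"
    using carrier_matD[OF B_carrier] by (intro eq_vecI) (auto simp: B_mult_vec_index simp del: index_mult_mat_vec)
  moreover have "cycle_vector e f \<in> \<int>" for f
    using e by (auto simp: cycle_vector_def walk_vector_Ints head_less tail_less)
  ultimately show ?thesis
    unfolding cycle_space_def integral_vectors_def by auto
qed

text \<open>Replacing each unit vector of an edge by its cycle changes \<open>z\<close> by a
  combination of walk vectors. Their coefficients are the entries of \<open>B\<close> applied to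
  \<open>z\<close>, which vanish. The coefficients \<open>z e\<close> may be arbitrary
  reals.\<close>

lemma kernel_expansion:
  assumes z: "\<And>i. i < n \<Longrightarrow> (\<Sum>e<m. B $$ (i, e) * z e) = 0" and f: "f < m"
  shows "z f = (\<Sum>e<m. z e * cycle_vector e f)"
proof -
  have "(\<Sum>e<m. z e * (walk_vector (head G e) f - walk_vector (tail G e) f))
      = (\<Sum>i<n. walk_vector i f * (\<Sum>e<m. B $$ (i, e) * z e))"
    by (rule sum_mult_gradient[where f = "\<lambda>i. walk_vector i f"])
  also have "\<dots> = 0" by (simp add: z)
  finally have "(\<Sum>e<m. z e * (walk_vector (head G e) f - walk_vector (tail G e) f)) = 0" .
  moreover have "(\<Sum>e<m. z e * cycle_vector e f) = (\<Sum>e<m. z e * of_bool (f = e))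
      - (\<Sum>e<m. z e * (walk_vector (head G e) f - walk_vector (tail G e) f))"
    by (simp add: cycle_vector_def algebra_simps sum.distrib sum_subtractf)
  moreover have "(\<Sum>e<m. z e * of_bool (f = e)) = z f"
    by (rule sum_mult_of_bool_eq[OF f])
  ultimately show ?thesis by simp
qed

section \<open>The pseudoinverse of the incidence matrix\<close>

definition mean_projection :: "real mat" where
  "mean_projection = mat n n (\<lambda>_. 1 / real n)"

lemma mean_projection_carrier [simp]: "mean_projection \<in> carrier_mat n n"
  by (simp add: mean_projection_def)

lemma mean_projection_mult_vec:
  "x \<in> carrier_vec n \<Longrightarrow> i < n \<Longrightarrow> (mean_projection *\<^sub>v x) $ i = (\<Sum>j<n. x $ j) / real n"
  by (auto simp: mean_projection_def scalar_prod_def lessThan_atLeast0 sum_divide_distrib)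

lemma transpose_mean_projection [simp]: "transpose_mat mean_projection = mean_projection"
  by (auto simp: mean_projection_def)

lemma mean_projection_idem: "mean_projection * mean_projection = mean_projection"
  using n_pos by (auto simp: mean_projection_def scalar_prod_def)

text \<open>\<open>mean_projection\<close> is the orthogonal projection onto the constant vectors,
  and every column of \<open>B\<close> is orthogonal to these.\<close>

lemma mean_projection_B: "mean_projection * B = 0\<^sub>m n m"
proof (rule eq_matI)
  fix i e assume "i < dim_row (0\<^sub>m n m :: real mat)" "e < dim_col (0\<^sub>m n m :: real mat)"
  then show "(mean_projection * B) $$ (i, e) = 0\<^sub>m n m $$ (i, e)"
    using carrier_matD[OF B_carrier] sum_B_column[of e]
    by (simp add: mean_projection_def scalar_prod_def lessThan_atLeast0 flip: sum_divide_distrib)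
qed (use carrier_matD[OF B_carrier] in \<open>auto simp: mean_projection_def\<close>)

lemma B_transpose_mean_projection: "transpose_mat B * mean_projection = 0\<^sub>m m n"
  using arg_cong[OF mean_projection_B, of transpose_mat]
  by (simp add: transpose_mult[OF mean_projection_carrier B_carrier])

text \<open>
  For a connected graph the pseudoinverse is \<open>B\<^sup>T (B B\<^sup>T + J / n)\<^sup>-\<^sup>1\<close>, where \<open>J\<close> is the all-ones matrix:
  \<open>J\<close> annihilates \<open>B\<close>, and the matrix in parentheses fixes \<open>J\<close>.
\<close>

definition regularized_laplacian :: "real mat" where
  "regularized_laplacian = B * transpose_mat B + mean_projection"


lemma laplacian_carrier [simp]: "B * transpose_mat B \<in> carrier_mat n n"
  by (rule mult_carrier_mat[of _ n m]) auto

lemma regularized_laplacian_carrier [simp]: "regularized_laplacian \<in> carrier_mat n n"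
  by (simp add: regularized_laplacian_def)

lemma transpose_regularized_laplacian: "transpose_mat regularized_laplacian = regularized_laplacian"
  using transpose_mult[OF B_carrier, of "transpose_mat B" n]
    transpose_add[OF laplacian_carrier mean_projection_carrier]
  by (simp add: regularized_laplacian_def)

lemma regularized_laplacian_mean_projection:
  "regularized_laplacian * mean_projection = mean_projection"
proof -
  have "regularized_laplacian * mean_projection
      = B * transpose_mat B * mean_projection + mean_projection * mean_projection"
    unfolding regularized_laplacian_def
    by (rule add_mult_distrib_mat[OF laplacian_carrier mean_projection_carrier mean_projection_carrier])
  also have "B * transpose_mat B * mean_projection = B * (transpose_mat B * mean_projection)"
    by (rule assoc_mult_mat[of _ n m _ n _ n]) auto
  finally show ?thesis
    by (simp add: B_transpose_mean_projection mean_projection_idem right_mult_zero_mat[of B n m])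
qed

text \<open>Energy argument: pairing the equation with \<open>x\<close> gives the squared norm of
  the gradient of \<open>x\<close> plus \<open>s\<^sup>2 / n\<close>, where \<open>s\<close> is the
  sum of the entries. Both terms vanish, so \<open>x\<close> is constant along walks from 0 and has
  sum 0.\<close>

lemma regularized_laplacian_kernel:
  assumes x: "x \<in> carrier_vec n" and zero: "regularized_laplacian *\<^sub>v x = 0\<^sub>v n"
  shows "x = 0\<^sub>v n"
proof -
  define y where "y = transpose_mat B *\<^sub>v x"
  have y: "y \<in> carrier_vec m" unfolding y_def by (rule mult_mat_vec_carrier[of _ m n]) (auto simp: x)
  have y_index: "y $ e = x $ head G e - x $ tail G e" if "e < m" for e
    using that x carrier_matD[OF B_carrier] sum_mult_B[OF that, of "\<lambda>i. x $ i"]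
    by (simp add: y_def scalar_prod_def lessThan_atLeast0 mult.commute)
  define s where "s = (\<Sum>j<n. x $ j)"
  have "regularized_laplacian *\<^sub>v x = B *\<^sub>v y + mean_projection *\<^sub>v x"
    unfolding regularized_laplacian_def y_def
    using add_mult_distrib_mat_vec[OF laplacian_carrier mean_projection_carrier x]
      assoc_mult_mat_vec[OF B_carrier _ x, of "transpose_mat B"] by simp
  then have row: "(\<Sum>e<m. B $$ (i, e) * y $ e) + s / n = 0" if "i < n" for i
    using arg_cong[OF zero, of "\<lambda>v. v $ i"] that x y carrier_matD[OF mean_projection_carrier]
    by (simp add: B_mult_vec_index mean_projection_mult_vec s_def del: index_mult_mat_vec)
  have "(\<Sum>e<m. (y $ e)\<^sup>2) = (\<Sum>e<m. y $ e * (x $ head G e - x $ tail G e))"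
    by (simp add: y_index power2_eq_square)
  also have "\<dots> = (\<Sum>i<n. x $ i * (\<Sum>e<m. B $$ (i, e) * y $ e))"
    by (rule sum_mult_gradient)
  also have "\<dots> = (\<Sum>i<n. x $ i * (- s / n))"
    using row by (intro sum.cong) (auto simp: add_eq_0_iff2)
  also have "\<dots> = - s\<^sup>2 / n"
    unfolding s_def sum_distrib_right[symmetric] by (simp add: power2_eq_square)
  finally have sq: "(\<Sum>e<m. (y $ e)\<^sup>2) + s\<^sup>2 / n = 0" by simp
  have "0 \<le> (\<Sum>e<m. (y $ e)\<^sup>2)" "0 \<le> s\<^sup>2 / n" by (auto intro: sum_nonneg)
  with sq have "(\<Sum>e<m. (y $ e)\<^sup>2) = 0" "s\<^sup>2 / n = 0" by linarith+
  then have y0: "\<And>e. e < m \<Longrightarrow> y $ e = 0" and s0: "s = 0"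
    using n_pos by (auto simp: sum_nonneg_eq_0_iff)
  have const: "x $ v = x $ 0" if "v < n" for v
  proof -
    have "(\<Sum>e<m. walk_vector v e * (x $ head G e - x $ tail G e)) = 0"
      by (intro sum.neutral) (metis lessThan_iff mult_zero_right y0 y_index)
    then show ?thesis using sum_walk_vector[OF that, of "\<lambda>i. x $ i"] by simp
  qed
  then have "s = (\<Sum>j<n. x $ 0)" unfolding s_def by (metis (no_types, lifting) lessThan_iff sum.cong)
  then have "s = n * x $ 0" by simp
  then have "x $ 0 = 0" using s0 n_pos by simp
  then have "x $ i = 0" if "i < n" for i using const[OF that] by metis
  then show ?thesis using x by (intro eq_vecI) auto
qed

text \<open>The trivial kernel gives an inverse \<open>R\<close> of the regularized Laplacian. It
  inherits symmetry and fixes \<open>mean_projection\<close>, which is what the Penrose conditions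
  for \<open>transpose_mat B * R\<close> come down to.\<close>

lemma incidence_matrix_mult_pseudoinverse:
  "pseudoinverse B \<in> carrier_mat m n" "B * pseudoinverse B = 1\<^sub>m n - mean_projection"
proof -
  have "det regularized_laplacian \<noteq> 0"
    using regularized_laplacian_kernel det_0_iff_vec_prod_zero[OF regularized_laplacian_carrier] by blast
  \<comment> \<open>The argument \<open>()\<close> merely fills the extension slot of the ring
    record. A unit of this ring has a two-sided inverse.\<close>
  from det_non_zero_imp_unit[OF regularized_laplacian_carrier this, of "()"]
  obtain R where R: "R \<in> carrier_mat n n" "R * regularized_laplacian = 1\<^sub>m n"
      "regularized_laplacian * R = 1\<^sub>m n"
    unfolding Units_def ring_mat_def by auto
  have RT: "transpose_mat R = R"
  proof -
    have "transpose_mat R * regularized_laplacian = 1\<^sub>m n"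
      using arg_cong[OF R(3), of transpose_mat] transpose_mult[OF regularized_laplacian_carrier R(1)]
      by (simp add: transpose_regularized_laplacian)
    then have "transpose_mat R * regularized_laplacian * R = 1\<^sub>m n * R" by simp
    moreover have "transpose_mat R * regularized_laplacian * R = transpose_mat R * (regularized_laplacian * R)"
      by (rule assoc_mult_mat) (use R in auto)
    ultimately show ?thesis using R by simp
  qed
  have RJ: "R * mean_projection = mean_projection"
  proof -
    have "R * mean_projection = R * (regularized_laplacian * mean_projection)"
      by (simp add: regularized_laplacian_mean_projection)
    also have "\<dots> = R * regularized_laplacian * mean_projection"
      by (rule assoc_mult_mat[OF R(1) regularized_laplacian_carrier mean_projection_carrier, symmetric])
    finally show ?thesis by (simp add: R left_mult_one_mat[of _ n n])
  qed
  have JR: "mean_projection * R = mean_projection"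
    using arg_cong[OF RJ, of transpose_mat] transpose_mult[OF R(1) mean_projection_carrier]
    by (simp add: RT)
  define X where "X = transpose_mat B * R"
  have X: "X \<in> carrier_mat m n" unfolding X_def by (rule mult_carrier_mat[of _ m n]) (use R in auto)
  have BX: "B * X = 1\<^sub>m n - mean_projection"
  proof -
    have "(B * transpose_mat B + mean_projection) * R = B * transpose_mat B * R + mean_projection * R"
      by (rule add_mult_distrib_mat[OF laplacian_carrier mean_projection_carrier R(1)])
    also have "B * transpose_mat B * R = B * X"
      unfolding X_def by (rule assoc_mult_mat[OF B_carrier _ R(1)]) simp
    finally have sum: "B * X + mean_projection = 1\<^sub>m n"
      using R(3) JR by (simp add: regularized_laplacian_def)
    have BX: "B * X \<in> carrier_mat n n" by (rule mult_carrier_mat[OF B_carrier X])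
    show ?thesis
    proof (rule eq_matI)
      fix i j assume "i < dim_row (1\<^sub>m n - mean_projection)" "j < dim_col (1\<^sub>m n - mean_projection)"
      then have ij: "i < n" "j < n" using carrier_matD[OF mean_projection_carrier] by auto
      have "(B * X + mean_projection) $$ (i, j) = (B * X) $$ (i, j) + mean_projection $$ (i, j)"
        using ij carrier_matD[OF mean_projection_carrier] by (intro index_add_mat(1)) auto
      then have "(B * X) $$ (i, j) = 1\<^sub>m n $$ (i, j) - mean_projection $$ (i, j)"
        unfolding sum by linarith
      also have "\<dots> = (1\<^sub>m n - mean_projection) $$ (i, j)"
        using ij carrier_matD[OF mean_projection_carrier] by (intro index_minus_mat(1)[symmetric]) auto
      finally show "(B * X) $$ (i, j) = (1\<^sub>m n - mean_projection) $$ (i, j)" .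
    qed (use carrier_matD[OF BX] carrier_matD[OF mean_projection_carrier] in auto)
  qed
  have pinv: "is_pseudoinverse B X"
    unfolding is_pseudoinverse_def
  proof (intro conjI)
    show "X \<in> carrier_mat (dim_col B) (dim_row B)" using X carrier_matD[OF B_carrier] by simp
    have "(1\<^sub>m n - mean_projection) * B = 1\<^sub>m n * B - mean_projection * B"
      by (rule minus_mult_distrib_mat[OF one_carrier_mat mean_projection_carrier B_carrier])
    moreover have "B - 0\<^sub>m n m = B"
      using carrier_matD[OF B_carrier] by (intro eq_matI) auto
    ultimately show "B * X * B = B"
      unfolding BX by (simp add: mean_projection_B left_mult_one_mat[of _ n m])
    have "X * mean_projection = transpose_mat B * (R * mean_projection)"
      unfolding X_def by (rule assoc_mult_mat[OF _ R(1) mean_projection_carrier, of _ m]) simp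
    then have XJ: "X * mean_projection = 0\<^sub>m m n" by (simp add: RJ B_transpose_mean_projection)
    have "X * B * X = X * (B * X)" by (rule assoc_mult_mat[OF X B_carrier X])
    also have "\<dots> = X * 1\<^sub>m n - X * mean_projection"
      unfolding BX by (rule mult_minus_distrib_mat[OF X one_carrier_mat mean_projection_carrier])
    also have "\<dots> = X" unfolding XJ using X by (intro eq_matI) auto
    finally show "X * B * X = X" .
    show "transpose_mat (B * X) = B * X" unfolding BX by (auto simp: mean_projection_def)
    have BT: "transpose_mat B \<in> carrier_mat m n" by simp
    have "transpose_mat (X * B) = transpose_mat B * (transpose_mat R * B)"
      unfolding transpose_mult[OF X B_carrier] unfolding X_def transpose_mult[OF BT R(1)] by simp
    also have "\<dots> = X * B"
      unfolding RT X_def by (rule assoc_mult_mat[OF BT R(1) B_carrier, symmetric])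
    finally show "transpose_mat (X * B) = X * B" .
  qed
  then have "pseudoinverse B = X"
    unfolding pseudoinverse_def by (intro the_equality pseudoinverse_unique[OF _ pinv])
  then show "pseudoinverse B \<in> carrier_mat m n" "B * pseudoinverse B = 1\<^sub>m n - mean_projection"
    using X BX by auto
qed

text \<open>All later use of the pseudoinverse goes through these two facts. The balance at the
  vertices can be met only up to the mean, since everything in the range of \<open>B\<close> sums to
  0.\<close>

lemma pseudoinverse_mult_vec:
  assumes w: "w \<in> carrier_vec n"
  shows "pseudoinverse B *\<^sub>v w \<in> carrier_vec m"
    and "i < n \<Longrightarrow> (\<Sum>e<m. B $$ (i, e) * (pseudoinverse B *\<^sub>v w) $ e) = w $ i - (\<Sum>j<n. w $ j) / n"
proof -
  show c: "pseudoinverse B *\<^sub>v w \<in> carrier_vec m"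
    by (rule mult_mat_vec_carrier[OF incidence_matrix_mult_pseudoinverse(1) w])
  assume i: "i < n"
  have "B *\<^sub>v (pseudoinverse B *\<^sub>v w) = (1\<^sub>m n - mean_projection) *\<^sub>v w"
    using assoc_mult_mat_vec[OF B_carrier incidence_matrix_mult_pseudoinverse(1) w]
    by (simp add: incidence_matrix_mult_pseudoinverse(2))
  also have "\<dots> = 1\<^sub>m n *\<^sub>v w - mean_projection *\<^sub>v w"
    by (rule minus_mult_distrib_mat_vec) (use w in auto)
  finally show "(\<Sum>e<m. B $$ (i, e) * (pseudoinverse B *\<^sub>v w) $ e) = w $ i - (\<Sum>j<n. w $ j) / n"
    using i w B_mult_vec_index[OF c i] carrier_matD[OF mean_projection_carrier]
    by (simp add: mean_projection_mult_vec del: index_mult_mat_vec)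
qed

section \<open>Edge differences, velocities and relative fixed points\<close>

lemma gradient_in_angle_lattice:
  assumes "\<And>e. e < m \<Longrightarrow> (f (head G e) - f (tail G e)) \<in> angle_lattice" "v < n"
  shows "f v - f 0 \<in> angle_lattice"
proof -
  \<comment> \<open>Walk vectors are integral, so the sum stays in the lattice; it telescopes to the
    claimed difference.\<close>
  have "(\<Sum>e<m. walk_vector v e * (f (head G e) - f (tail G e))) \<in> angle_lattice"
    using assms by (intro angle_lattice_sum angle_lattice_mult_Ints walk_vector_Ints) auto
  then show ?thesis by (simp only: sum_walk_vector[OF assms(2)])
qed

text \<open>In a simple graph at most one edge passes the test. The sum replaces the description
  operator, so that it can be exchanged with the sum over vertices.\<close>

lemma coupling_eq_sum:
  "coupling G \<gamma> i j = (\<Sum>e<m. if {tail G e, head G e} = {i, j} then \<gamma> e else 0)"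
proof (cases "\<exists>e\<in>arcs G. {tail G e, head G e} = {i, j}")
  case True
  then obtain f where f: "f < m" "{tail G f, head G f} = {i, j}" by (auto simp: arcs_conv)
  have "{tail G e, head G e} = {i, j} \<longleftrightarrow> e = f" if "e < m" for e
    using arc_eqI[OF that f(1)] f(2) by auto
  then have "(\<Sum>e<m. if {tail G e, head G e} = {i, j} then \<gamma> e else 0) = (\<Sum>e<m. if e = f then \<gamma> e else 0)"
    by (intro sum.cong) auto
  moreover have "(THE e. e \<in> arcs G \<and> {tail G e, head G e} = {i, j}) = f"
  proof (rule the_equality)
    show "f \<in> arcs G \<and> {tail G f, head G f} = {i, j}" using f by (simp add: arcs_conv)
    show "e = f" if "e \<in> arcs G \<and> {tail G e, head G e} = {i, j}" for e
      by (rule arc_eqI[OF _ f(1)]) (use that f(2) in \<open>simp_all add: arcs_conv\<close>)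
  qed
  ultimately show ?thesis using True f(1) unfolding coupling_def by simp
next
  case False
  then show ?thesis unfolding coupling_def by (auto simp: arcs_conv intro!: sum.neutral[symmetric])
qed

text \<open>Sine is odd, so an edge acts on its tail with the opposite sign to its head. This sign
  is the incidence entry.\<close>

lemma velocity_eq:
  assumes i: "i < n"
  shows "velocity G \<gamma> \<omega> \<theta> i = \<omega> $ i - (\<Sum>e<m. B $$ (i, e) * (\<gamma> e * sin (angle_difference G \<theta> e)))"
proof -
  have "(\<Sum>j<n. (if {tail G e, head G e} = {i, j} then \<gamma> e else 0) * sin (\<theta> $ i - \<theta> $ j))
      = B $$ (i, e) * (\<gamma> e * sin (angle_difference G \<theta> e))" if e: "e < m" for e
  proof -
    \<comment> \<open>The end point of \<open>e\<close> opposite to \<open>i\<close>. If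
      \<open>i\<close> is not an end point, the value is a dummy and all terms vanish.\<close>
    define other where "other = (if i = head G e then tail G e else head G e)"
    have other: "other < n" using head_less[OF e] tail_less[OF e] by (auto simp: other_def)
    have "(\<Sum>j<n. (if {tail G e, head G e} = {i, j} then \<gamma> e else 0) * sin (\<theta> $ i - \<theta> $ j))
      = (\<Sum>j<n. if j = other then (if i \<in> {tail G e, head G e} then \<gamma> e * sin (\<theta> $ i - \<theta> $ j) else 0) else 0)"
      using tail_neq_head[OF e] by (intro sum.cong) (auto simp: other_def doubleton_eq_iff)
    also have "\<dots> = (if i \<in> {tail G e, head G e} then \<gamma> e * sin (\<theta> $ i - \<theta> $ other) else 0)"
      using other by simp
    also have "\<dots> = B $$ (i, e) * (\<gamma> e * sin (angle_difference G \<theta> e))"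
      unfolding B_index[OF i e] angle_difference_def other_def
      using tail_neq_head[OF e] sin_minus[of "\<theta> $ head G e - \<theta> $ tail G e"] by auto
    finally show ?thesis .
  qed
  then have "(\<Sum>e<m. \<Sum>j<n. (if {tail G e, head G e} = {i, j} then \<gamma> e else 0) * sin (\<theta> $ i - \<theta> $ j))
      = (\<Sum>e<m. B $$ (i, e) * (\<gamma> e * sin (angle_difference G \<theta> e)))"
    by (intro sum.cong) auto
  then show ?thesis
    unfolding velocity_def coupling_eq_sum sum_distrib_right by (subst sum.swap) simp
qed

text \<open>The two ends of each edge receive opposite contributions, so the interactions cancel in
  total. Hence a common velocity can only be the mean frequency.\<close>

lemma sum_velocity: "(\<Sum>i<n. velocity G \<gamma> \<omega> \<theta> i) = (\<Sum>i<n. \<omega> $ i)"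
proof -
  have "(\<Sum>i<n. \<Sum>e<m. B $$ (i, e) * (\<gamma> e * sin (angle_difference G \<theta> e)))
      = (\<Sum>e<m. (\<Sum>i<n. B $$ (i, e)) * (\<gamma> e * sin (angle_difference G \<theta> e)))"
    by (subst sum.swap) (simp add: sum_distrib_right)
  then show ?thesis by (simp add: velocity_eq sum_subtractf sum_B_column)
qed

lemma uniform_velocity:
  assumes "\<And>i. i < n \<Longrightarrow> velocity G \<gamma> \<omega> \<theta> i = u" shows "u = (\<Sum>i<n. \<omega> $ i) / n"
  using sum_velocity[of \<gamma> \<omega> \<theta>] assms n_pos by (simp add: field_simps)

lemma relative_fixed_points_eq_fixed_points:
  assumes "(\<Sum>i<n. \<omega> $ i) = 0" shows "relative_fixed_points G \<gamma> \<omega> = fixed_points G \<gamma> \<omega>"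
  unfolding relative_fixed_points_def fixed_points_def
  using uniform_velocity[of \<gamma> \<omega>] assms by fastforce

text \<open>A common velocity equals the mean, and the mean is exactly what
  \<open>B * pseudoinverse B\<close> removes from \<omega>. The fixed point equation thus becomes
  membership in the kernel of \<open>B\<close>.\<close>

lemma relative_fixed_points_iff:
  assumes \<omega>: "\<omega> \<in> carrier_vec n"
  shows "\<theta> \<in> relative_fixed_points G \<gamma> \<omega> \<longleftrightarrow> \<theta> \<in> carrier_vec n \<and>
    (\<forall>i<n. (\<Sum>e<m. B $$ (i, e) * (\<gamma> e * sin (angle_difference G \<theta> e) - (pseudoinverse B *\<^sub>v \<omega>) $ e)) = 0)"
proof -
  have "(\<Sum>e<m. B $$ (i, e) * (\<gamma> e * sin (angle_difference G \<theta> e) - (pseudoinverse B *\<^sub>v \<omega>) $ e))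
     = (\<Sum>j<n. \<omega> $ j) / n - velocity G \<gamma> \<omega> \<theta> i" if "i < n" for i
    unfolding right_diff_distrib sum_subtractf pseudoinverse_mult_vec(2)[OF \<omega> that] velocity_eq[OF that]
    by simp
  then show ?thesis
    unfolding relative_fixed_points_def using uniform_velocity[of \<gamma> \<omega> \<theta>]
    by (auto intro!: exI[of _ "(\<Sum>j<n. \<omega> $ j) / n"])
qed

end

section \<open>Cycle bases: integer and real coordinates, potentials\<close>

locale kuramoto_network = connected_network +
  fixes \<gamma> :: "nat \<Rightarrow> real" and \<omega> :: "real vec" and I :: "nat \<Rightarrow> real set" and vs :: "real vec list"
  assumes weight_nonzero: "e < m \<Longrightarrow> \<gamma> e \<noteq> 0"
    and frequencies: "\<omega> \<in> carrier_vec n"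
    and sin_inj: "e < m \<Longrightarrow> inj_on sin (I e)"
    and basis: "cycle_basis G vs"
begin

abbreviation c :: nat where "c \<equiv> length vs"
abbreviation v :: "nat \<Rightarrow> nat \<Rightarrow> real" where "v j e \<equiv> vs ! j $ e"

lemma basis_carrier: "j < c \<Longrightarrow> vs ! j \<in> carrier_vec m"
  and basis_Ints: "j < c \<Longrightarrow> e < m \<Longrightarrow> v j e \<in> \<int>"
  and basis_kernel: "j < c \<Longrightarrow> i < n \<Longrightarrow> (\<Sum>e<m. B $$ (i, e) * v j e) = 0"
  and basis_in_cycle_space: "j < c \<Longrightarrow> vs ! j \<in> cycle_space G"
proof -
  assume j: "j < c"
  then show *: "vs ! j \<in> cycle_space G"
    using basis by (auto simp: cycle_basis_def)
  then show car: "vs ! j \<in> carrier_vec m"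
    by (auto simp: cycle_space_def integral_vectors_def)
  show "v j e \<in> \<int>" if "e < m"
    using * that by (auto simp: cycle_space_def integral_vectors_def)
  show "(\<Sum>e<m. B $$ (i, e) * v j e) = 0" if "i < n"
    using * that B_mult_vec_index[OF car that] by (auto simp: cycle_space_def simp del: index_mult_mat_vec)
qed

lemma finsum_basis_index:
  "e < m \<Longrightarrow> finsum_vec TYPE(real) m (\<lambda>j. f j \<cdot>\<^sub>v vs ! j) {..<c} $ e = (\<Sum>j<c. f j * v j e)"
  using basis_carrier by (subst index_finsum_vec) (auto simp: carrier_vecD[OF basis_carrier] intro!: sum.cong)

lemma finsum_basis_carrier:
  "finsum_vec TYPE(real) m (\<lambda>j. f j \<cdot>\<^sub>v vs ! j) {..<c} \<in> carrier_vec m"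
  using basis_carrier by (intro finsum_vec_closed) auto

lemma ex_integer_coordinates:
  assumes "x \<in> cycle_space G"
  shows "\<exists>k. \<forall>e<m. x $ e = (\<Sum>j<c. real_of_int (k j) * v j e)"
proof -
  obtain k :: "int vec" where "x = finsum_vec TYPE(real) m (\<lambda>j. of_int (k $ j) \<cdot>\<^sub>v vs ! j) {..<c}"
    using basis assms unfolding cycle_basis_def by blast
  then show ?thesis by (intro exI[of _ "\<lambda>j. k $ j"]) (simp add: finsum_basis_index)
qed

text \<open>Both \<open>k\<close> and the indicator of \<open>i\<close> are integer coordinates of
  the same basis vector, so the uniqueness in \<open>cycle_basis\<close> identifies them. This is
  the only place where independence over the integers enters.\<close>

lemma integer_coordinates_basis:
  assumes i: "i < c" and eq: "\<And>e. e < m \<Longrightarrow> v i e = (\<Sum>j<c. real_of_int (k j) * v j e)" and j: "j < c"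
  shows "k j = of_bool (j = i)"
proof -
  have witness: "vs ! i = finsum_vec TYPE(real) m (\<lambda>j. of_int (vec c k' $ j) \<cdot>\<^sub>v vs ! j) {..<c}"
    if "\<And>e. e < m \<Longrightarrow> v i e = (\<Sum>j<c. real_of_int (k' j) * v j e)" for k' :: "nat \<Rightarrow> int"
    using that carrier_vecD[OF basis_carrier[OF i]] carrier_vecD[OF finsum_basis_carrier]
    by (intro eq_vecI) (simp_all add: finsum_basis_index)
  have "\<exists>!k :: int vec. k \<in> carrier_vec c \<and>
      vs ! i = finsum_vec TYPE(real) m (\<lambda>j. of_int (k $ j) \<cdot>\<^sub>v vs ! j) {..<c}"
    using basis basis_in_cycle_space[OF i] unfolding cycle_basis_def by blast
  moreover have "vs ! i = finsum_vec TYPE(real) m (\<lambda>j. of_int (vec c (\<lambda>j. of_bool (j = i)) $ j) \<cdot>\<^sub>v vs ! j) {..<c}"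
  proof (rule witness)
    fix e show "v i e = (\<Sum>j<c. real_of_int (of_bool (j = i)) * v j e)"
      using sum_mult_of_bool_eq(1)[OF i, of "\<lambda>j. v j e"] by (simp add: mult.commute)
  qed
  ultimately have "vec c k = vec c (\<lambda>j. of_bool (j = i))"
    using witness[OF eq] vec_carrier by blast
  then show ?thesis using j by (metis index_vec)
qed

text \<open>
  The integer coordinates of the cycle vectors define a linear functional on \<open>\<real>\<^sup>E\<close> that reads off
  the \<open>j\<close>-th coordinate on the whole real kernel of \<open>B\<close>.
\<close>

definition cycle_coordinate :: "nat \<Rightarrow> nat \<Rightarrow> int" where
  "cycle_coordinate e = (SOME k. \<forall>f<m. cycle_vector e f = (\<Sum>j<c. of_int (k j) * v j f))"

lemma cycle_vector_eq:
  assumes "e < m" "f < m" shows "cycle_vector e f = (\<Sum>j<c. of_int (cycle_coordinate e j) * v j f)"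
  using someI_ex[OF ex_integer_coordinates[OF cycle_vector_in_cycle_space[OF assms(1)]]] assms(2)
  unfolding cycle_coordinate_def by simp

definition coordinate :: "nat \<Rightarrow> (nat \<Rightarrow> real) \<Rightarrow> real" where
  "coordinate j z = (\<Sum>e<m. z e * of_int (cycle_coordinate e j))"

text \<open>Each cycle in \<open>kernel_expansion\<close> is itself an integer combination of the
  basis. Exchanging the sums collects the coefficients in \<open>coordinate\<close>.\<close>

lemma kernel_basis_expansion:
  assumes "\<And>i. i < n \<Longrightarrow> (\<Sum>e<m. B $$ (i, e) * z e) = 0" and f: "f < m"
  shows "z f = (\<Sum>j<c. coordinate j z * v j f)"
proof -
  have "z f = (\<Sum>e<m. z e * cycle_vector e f)" by (rule kernel_expansion[OF assms])
  also have "\<dots> = (\<Sum>e<m. \<Sum>j<c. z e * of_int (cycle_coordinate e j) * v j f)"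
    by (simp add: cycle_vector_eq f sum_distrib_left mult.assoc)
  also have "\<dots> = (\<Sum>j<c. coordinate j z * v j f)"
    unfolding coordinate_def by (subst sum.swap) (simp add: sum_distrib_right)
  finally show ?thesis .
qed

text \<open>Here independence passes from the integers to the reals: a basis vector has integral
  entries, so its coordinates are integers too, and uniqueness over the integers determines
  them.\<close>

lemma coordinate_basis:
  assumes "i < c" "j < c" shows "coordinate j (v i) = of_bool (j = i)"
proof -
  have floor: "real_of_int \<lfloor>v i e\<rfloor> = v i e" if "e < m" for e
    using basis_Ints[OF assms(1) that] by simp
  \<comment> \<open>The floors only convert integral reals to type \<open>int\<close>.\<close>
  define k where "k j = (\<Sum>e<m. \<lfloor>v i e\<rfloor> * cycle_coordinate e j)" for j
  have k: "real_of_int (k j) = coordinate j (v i)" for j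
    unfolding k_def coordinate_def by (simp add: floor)
  have "k j = of_bool (j = i)"
    by (rule integer_coordinates_basis[OF assms(1) _ assms(2)])
      (unfold k, rule kernel_basis_expansion[OF basis_kernel[OF assms(1)]])
  then show ?thesis unfolding k[symmetric] by simp
qed

lemma coordinate_combination:
  assumes j: "j < c" shows "coordinate j (\<lambda>e. \<Sum>i<c. a i * v i e) = a j"
proof -
  have "coordinate j (\<lambda>e. \<Sum>i<c. a i * v i e) = (\<Sum>i<c. a i * coordinate j (v i))"
    unfolding coordinate_def sum_distrib_right sum_distrib_left
    by (subst sum.swap) (simp add: mult.assoc)
  also have "\<dots> = (\<Sum>i<c. a i * of_bool (j = i))" by (simp add: coordinate_basis j)
  also have "\<dots> = a j" by (rule sum_mult_of_bool_eq[OF j])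
  finally show ?thesis .
qed

text \<open>Integrate \<open>x\<close> along the walks. The defect on an edge is, up to sign, the
  sum of \<open>x\<close> around its cycle, an integer combination of the sums around basis
  cycles.\<close>

lemma ex_potential:
  assumes "\<And>j. j < c \<Longrightarrow> (\<Sum>e<m. v j e * x e) \<in> angle_lattice"
  shows "\<exists>\<theta>\<in>carrier_vec n. \<forall>e<m. angle_difference G \<theta> e - x e \<in> angle_lattice"
proof -
  define \<theta> where "\<theta> = vec n (\<lambda>i. \<Sum>e<m. walk_vector i e * x e)"
  have "angle_difference G \<theta> e - x e \<in> angle_lattice" if e: "e < m" for e
  proof -
    have "(\<Sum>f<m. cycle_vector e f * x f) = (\<Sum>f<m. \<Sum>j<c. of_int (cycle_coordinate e j) * (v j f * x f))"
      by (simp add: cycle_vector_eq e sum_distrib_right mult.assoc)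
    also have "\<dots> = (\<Sum>j<c. of_int (cycle_coordinate e j) * (\<Sum>f<m. v j f * x f))"
      by (subst sum.swap) (simp add: sum_distrib_left)
    finally have "(\<Sum>f<m. cycle_vector e f * x f) \<in> angle_lattice"
      by (metis (no_types, lifting) Ints_of_int angle_lattice_mult_Ints angle_lattice_sum assms lessThan_iff)
    moreover have "(\<Sum>f<m. cycle_vector e f * x f) = x e - angle_difference G \<theta> e"
    proof -
      have "(\<Sum>f<m. of_bool (f = e) * x f) = x e"
        using sum_mult_of_bool_eq(1)[OF e, of x] by (simp only: mult.commute)
      then show ?thesis
        unfolding cycle_vector_def distrib_right left_diff_distrib sum.distrib sum_subtractf
        using head_less[OF e] tail_less[OF e] by (simp add: angle_difference_def \<theta>_def)
    qed
    ultimately show ?thesis by (metis angle_lattice_uminus_iff minus_diff_eq)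
  qed
  moreover have "\<theta> \<in> carrier_vec n" by (simp add: \<theta>_def)
  ultimately show ?thesis by blast
qed

section \<open>The maps \<open>L\<close> and \<open>W\<close> edge by edge\<close>

abbreviation b :: "nat \<Rightarrow> real" where "b e \<equiv> (pseudoinverse B *\<^sub>v \<omega>) $ e"
abbreviation L :: "real vec \<Rightarrow> real vec" where "L \<equiv> L_map G \<gamma> \<omega> vs"

lemma L_index:
  assumes e: "e < m" shows "L \<alpha> $ e = (b e + (\<Sum>j<c. \<alpha> $ j * v j e)) / \<gamma> e"
proof -
  have "finsum_vec TYPE(real) m (\<lambda>j. \<alpha> $ j \<cdot>\<^sub>v (mat_diag m (\<lambda>e. inverse (\<gamma> e)) *\<^sub>v vs ! j)) {..<c} $ e
      = (\<Sum>j<c. \<alpha> $ j * (inverse (\<gamma> e) * v j e))"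
    using e basis_carrier
    by (subst index_finsum_vec) (auto simp: mat_diag_mult_vec intro!: sum.cong)
  moreover have "finsum_vec TYPE(real) m (\<lambda>j. \<alpha> $ j \<cdot>\<^sub>v (mat_diag m (\<lambda>e. inverse (\<gamma> e)) *\<^sub>v vs ! j)) {..<c}
      \<in> carrier_vec m"
    using basis_carrier by (intro finsum_vec_closed) (auto simp: mat_diag_mult_vec)
  ultimately have "L \<alpha> $ e = inverse (\<gamma> e) * b e + (\<Sum>j<c. \<alpha> $ j * (inverse (\<gamma> e) * v j e))"
    using e unfolding L_map_def Let_def mat_diag_mult_vec[OF pseudoinverse_mult_vec(1)[OF frequencies]]
    by simp
  then show ?thesis
    by (simp add: divide_inverse sum_distrib_left distrib_left mult_ac)
qed

text \<open>For parameters outside \<open>A_set\<close> some values are not meaningful, because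
  \<open>the_inv_into\<close> is then applied outside the range of the restricted sine.\<close>

abbreviation phase :: "real vec \<Rightarrow> nat \<Rightarrow> real" where
  "phase \<alpha> e \<equiv> the_inv_into (I e) sin (L \<alpha> $ e)"

lemma W_integral_iff:
  "W_map G \<gamma> \<omega> I vs \<alpha> \<in> integral_vectors c \<longleftrightarrow>
    (\<forall>j<c. (\<Sum>e<m. v j e * phase \<alpha> e) \<in> angle_lattice)"
proof -
  have "W_map G \<gamma> \<omega> I vs \<alpha> $ j = 1 / (2 * pi) * (\<Sum>e<m. v j e * phase \<alpha> e)" if "j < c" for j
    using that by (simp add: W_map_def sin_inverse_def scalar_prod_def lessThan_atLeast0)
  moreover have "1 / (2 * pi) * s \<in> \<int> \<longleftrightarrow> s \<in> angle_lattice" for s :: real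
    unfolding angle_lattice_def Ints_def by (auto simp: image_iff field_simps)
  ultimately show ?thesis
    unfolding integral_vectors_def by (auto simp: W_map_def)
qed

section \<open>The correspondence between states and parameters\<close>

definition states :: "real vec set" where
  "states = relative_fixed_points G \<gamma> \<omega> \<inter> admissible_states G I"

definition lattice_parameters :: "real vec set" where
  "lattice_parameters = {\<alpha> \<in> A_set G \<gamma> \<omega> I vs. W_map G \<gamma> \<omega> I vs \<alpha> \<in> integral_vectors c}"

text \<open>For a state the argument of \<open>coordinate\<close> lies in the kernel of
  \<open>B\<close>, so these are true basis coordinates. For other \<theta> the functional is still
  defined but need not describe an expansion.\<close>

definition flow_parameter :: "real vec \<Rightarrow> real vec" where
  "flow_parameter \<theta> = vec c (\<lambda>j. coordinate j (\<lambda>e. \<gamma> e * sin (angle_difference G \<theta> e) - b e))"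

lemma states_carrier: "\<theta> \<in> states \<Longrightarrow> \<theta> \<in> carrier_vec n"
  by (simp add: states_def admissible_states_def)

lemma states_admissible:
  assumes "\<theta> \<in> states" "e < m"
  obtains x where "x \<in> I e" "angle_difference G \<theta> e - x \<in> angle_lattice"
  using assms unfolding states_def admissible_states_def angle_lattice_def
  by (force simp: arcs_conv)

text \<open>The kernel expansion recovers the edge flow minus \<open>b\<close>. Then
  \<open>L\<close> adds \<open>b\<close> back and divides by the nonzero weights.\<close>

lemma L_flow_parameter:
  assumes \<theta>: "\<theta> \<in> states" and e: "e < m"
  shows "L (flow_parameter \<theta>) $ e = sin (angle_difference G \<theta> e)"
proof -
  let ?z = "\<lambda>e. \<gamma> e * sin (angle_difference G \<theta> e) - b e"
  have "?z e = (\<Sum>j<c. coordinate j ?z * v j e)"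
    using \<theta> by (intro kernel_basis_expansion[OF _ e])
      (auto simp: states_def relative_fixed_points_iff[OF frequencies])
  then have "b e + (\<Sum>j<c. flow_parameter \<theta> $ j * v j e) = \<gamma> e * sin (angle_difference G \<theta> e)"
    by (simp add: flow_parameter_def)
  then show ?thesis using weight_nonzero[OF e] by (simp add: L_index[OF e])
qed

text \<open>Injectivity of sine on \<open>I e\<close> makes the admissible representative of an
  angle difference equal to the phase. Angle differences sum to 0 around every cycle, so the phases
  sum to a multiple of 2 pi.\<close>

lemma flow_parameter_in:
  assumes \<theta>: "\<theta> \<in> states" shows "flow_parameter \<theta> \<in> lattice_parameters"
proof -
  let ?\<alpha> = "flow_parameter \<theta>"
  have edge: "L ?\<alpha> $ e \<in> sin ` I e" "angle_difference G \<theta> e - phase ?\<alpha> e \<in> angle_lattice"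
    if e: "e < m" for e
  proof -
    obtain x where x: "x \<in> I e" "angle_difference G \<theta> e - x \<in> angle_lattice"
      using states_admissible[OF \<theta> e] .
    then have L: "L ?\<alpha> $ e = sin x"
      using L_flow_parameter[OF \<theta> e] sin_cong_angle_lattice by simp
    then show "L ?\<alpha> $ e \<in> sin ` I e" using x by simp
    show "angle_difference G \<theta> e - phase ?\<alpha> e \<in> angle_lattice"
      unfolding L the_inv_into_f_f[OF sin_inj[OF e] x(1)] by (rule x(2))
  qed
  have "(\<Sum>e<m. v j e * phase ?\<alpha> e) \<in> angle_lattice" if j: "j < c" for j
  proof -
    \<comment> \<open>A gradient is orthogonal to the kernel of \<open>B\<close>.\<close>
    have "(\<Sum>e<m. v j e * angle_difference G \<theta> e) = 0"
      unfolding angle_difference_def sum_mult_gradient[of "v j" "\<lambda>i. \<theta> $ i"]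
      by (simp add: basis_kernel[OF j])
    then have "(\<Sum>e<m. v j e * phase ?\<alpha> e)
        = - (\<Sum>e<m. v j e * (angle_difference G \<theta> e - phase ?\<alpha> e))"
      by (simp add: right_diff_distrib sum_subtractf)
    moreover have "(\<Sum>e<m. v j e * (angle_difference G \<theta> e - phase ?\<alpha> e)) \<in> angle_lattice"
      using edge basis_Ints[OF j] by (intro angle_lattice_sum angle_lattice_mult_Ints) auto
    ultimately show ?thesis by simp
  qed
  then show ?thesis
    using edge(1) unfolding lattice_parameters_def A_set_def W_integral_iff
    by (auto simp: arcs_conv flow_parameter_def)
qed

text \<open>Integrality lets the phases be integrated to a state \<theta>. By periodicity \<theta>
  carries the flow prescribed by \<alpha>, namely \<open>b\<close> plus a combination of cycles, and
  the coordinates of that combination are \<alpha> again.\<close>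

lemma flow_parameter_surj:
  assumes \<alpha>: "\<alpha> \<in> lattice_parameters" shows "\<exists>\<theta>\<in>states. flow_parameter \<theta> = \<alpha>"
proof -
  have \<alpha>_carrier: "\<alpha> \<in> carrier_vec c" and range: "\<And>e. e < m \<Longrightarrow> L \<alpha> $ e \<in> sin ` I e"
    and W: "\<And>j. j < c \<Longrightarrow> (\<Sum>e<m. v j e * phase \<alpha> e) \<in> angle_lattice"
    using \<alpha> unfolding lattice_parameters_def A_set_def W_integral_iff by (auto simp: arcs_conv)
  from ex_potential[OF W] obtain \<theta> where \<theta>: "\<theta> \<in> carrier_vec n"
    "\<And>e. e < m \<Longrightarrow> angle_difference G \<theta> e - phase \<alpha> e \<in> angle_lattice" by auto
  have phase: "phase \<alpha> e \<in> I e" "sin (phase \<alpha> e) = L \<alpha> $ e" if e: "e < m" for e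
    using f_the_inv_into_f[OF sin_inj[OF e] range[OF e]]
      the_inv_into_into[OF sin_inj[OF e] range[OF e]] by auto
  have flow: "\<gamma> e * sin (angle_difference G \<theta> e) - b e = (\<Sum>j<c. \<alpha> $ j * v j e)" if e: "e < m" for e
    using sin_cong_angle_lattice[OF \<theta>(2)[OF e]] phase(2)[OF e] weight_nonzero[OF e]
    by (simp add: L_index[OF e])
  have "(\<Sum>e<m. B $$ (i, e) * (\<gamma> e * sin (angle_difference G \<theta> e) - b e)) = 0" if i: "i < n" for i
  proof -
    have "(\<Sum>e<m. B $$ (i, e) * (\<gamma> e * sin (angle_difference G \<theta> e) - b e))
        = (\<Sum>e<m. \<Sum>j<c. \<alpha> $ j * (B $$ (i, e) * v j e))"
      by (intro sum.cong) (simp_all add: flow sum_distrib_left mult.left_commute del: right_diff_distrib)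
    also have "\<dots> = (\<Sum>j<c. \<alpha> $ j * (\<Sum>e<m. B $$ (i, e) * v j e))"
      by (subst sum.swap) (simp add: sum_distrib_left)
    finally show ?thesis by (simp add: basis_kernel[OF _ i])
  qed
  moreover have "\<theta> \<in> admissible_states G I"
  proof -
    have "\<exists>x\<in>I e. \<exists>k::int. angle_difference G \<theta> e = x + 2 * pi * of_int k" if e: "e < m" for e
    proof -
      obtain k :: int where "angle_difference G \<theta> e = phase \<alpha> e + 2 * pi * of_int k"
        using \<theta>(2)[OF e] unfolding angle_lattice_def by (auto simp: diff_eq_eq)
      then show ?thesis using phase(1)[OF e] by blast
    qed
    then show ?thesis using \<theta>(1) by (auto simp: admissible_states_def arcs_conv)
  qed
  ultimately have "\<theta> \<in> states"
    using \<theta>(1) by (auto simp: states_def relative_fixed_points_iff[OF frequencies])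
  moreover have "flow_parameter \<theta> = \<alpha>"
  proof (rule eq_vecI)
    fix j assume "j < dim_vec \<alpha>"
    then have j: "j < c" using \<alpha>_carrier by simp
    have "flow_parameter \<theta> $ j = coordinate j (\<lambda>e. \<Sum>i<c. \<alpha> $ i * v i e)"
      using j flow by (simp add: flow_parameter_def coordinate_def)
    then show "flow_parameter \<theta> $ j = \<alpha> $ j" by (simp add: coordinate_combination[OF j])
  qed (use \<alpha>_carrier in \<open>simp add: flow_parameter_def\<close>)
  ultimately show ?thesis by blast
qed

text \<open>Equal parameters give equal sines, hence equal representatives in \<open>I e\<close>, so
  the edge differences agree modulo 2 pi. Connectedness turns this into a common translation.
  Conversely, the parameter depends only on the sines of edge differences.\<close>

lemma flow_parameter_eq_iff:
  assumes \<theta>: "\<theta> \<in> states" and \<phi>: "\<phi> \<in> states"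
  shows "flow_parameter \<theta> = flow_parameter \<phi> \<longleftrightarrow> (\<theta>, \<phi>) \<in> angle_equiv G"
proof
  assume eq: "flow_parameter \<theta> = flow_parameter \<phi>"
  have edge: "angle_difference G \<phi> e - angle_difference G \<theta> e \<in> angle_lattice" if e: "e < m" for e
  proof -
    obtain x where x: "x \<in> I e" "angle_difference G \<theta> e - x \<in> angle_lattice"
      using states_admissible[OF \<theta> e] .
    obtain y where y: "y \<in> I e" "angle_difference G \<phi> e - y \<in> angle_lattice"
      using states_admissible[OF \<phi> e] .
    have "sin x = sin y"
      using L_flow_parameter[OF \<theta> e] L_flow_parameter[OF \<phi> e] eq
        sin_cong_angle_lattice[OF x(2)] sin_cong_angle_lattice[OF y(2)] by simp
    then have "x = y" using sin_inj[OF e] x(1) y(1) by (auto dest: inj_onD)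
    then show ?thesis using angle_lattice_diff[OF y(2) x(2)] by simp
  qed
  \<comment> \<open>The translation is read off at the base vertex 0 of the walks.\<close>
  have "\<phi> $ i - \<theta> $ i - (\<phi> $ 0 - \<theta> $ 0) \<in> angle_lattice" if "i < n" for i
    using gradient_in_angle_lattice[of "\<lambda>i. \<phi> $ i - \<theta> $ i", OF _ that] edge
    by (simp add: angle_difference_def algebra_simps)
  then show "(\<theta>, \<phi>) \<in> angle_equiv G"
    using states_carrier \<theta> \<phi> by (auto simp: angle_equiv_iff)
next
  assume "(\<theta>, \<phi>) \<in> angle_equiv G"
  then obtain t where t: "\<And>i. i < n \<Longrightarrow> \<phi> $ i - \<theta> $ i - t \<in> angle_lattice"
    by (auto simp: angle_equiv_iff)
  have "sin (angle_difference G \<phi> e) = sin (angle_difference G \<theta> e)" if e: "e < m" for e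
    using angle_lattice_diff[OF t[OF head_less[OF e]] t[OF tail_less[OF e]]]
    by (intro sin_cong_angle_lattice) (simp add: angle_difference_def algebra_simps)
  then show "flow_parameter \<theta> = flow_parameter \<phi>"
    by (simp add: flow_parameter_def coordinate_def)
qed

lemma ex_bij_betw_states_lattice_parameters:
  "\<exists>\<Phi>. bij_betw \<Phi> (states // angle_equiv G) lattice_parameters"
proof (rule bij_betw_quotient[OF equiv_angle_equiv])
  show "states \<subseteq> carrier_vec n" using states_carrier by blast
  show "flow_parameter ` states = lattice_parameters"
    using flow_parameter_in flow_parameter_surj by blast
qed (rule flow_parameter_eq_iff)

end

theorem theorem1:
  fixes G :: "(nat, nat) pre_digraph" and \<gamma> :: "nat \<Rightarrow> real" and \<omega> :: "real vec"
    and I :: "nat \<Rightarrow> real set" and vs :: "real vec list"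
  assumes "oriented_simple_graph G" and "numbered G" and "Digraph_Component.connected G"
    and "\<forall>e\<in>arcs G. \<gamma> e \<noteq> 0"
    and "\<forall>e\<in>arcs G. \<exists>T. undirected_spanning_tree T G \<and> e \<notin> arcs T"
    and "\<omega> \<in> carrier_vec (card (verts G))"
    and "\<forall>e\<in>arcs G. inj_on sin (I e)"
    and "cycle_basis G vs"
  defines "A \<equiv> A_set G \<gamma> \<omega> I vs" and "W \<equiv> W_map G \<gamma> \<omega> I vs"
    and "Z \<equiv> integral_vectors (length vs)"
    and "\<Theta> \<equiv> (relative_fixed_points G \<gamma> \<omega> \<inter> admissible_states G I) // angle_equiv G"
  shows "(\<exists>\<Phi>. bij_betw \<Phi> \<Theta> {\<alpha> \<in> A. W \<alpha> \<in> Z} \<and>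
            (inj_on W {\<alpha> \<in> A. W \<alpha> \<in> Z} \<longrightarrow> bij_betw (W \<circ> \<Phi>) \<Theta> (W ` A \<inter> Z))) \<and>
         ((\<Sum>i<card (verts G). \<omega> $ i) = 0 \<longrightarrow>
            \<Theta> = (fixed_points G \<gamma> \<omega> \<inter> admissible_states G I) // angle_equiv G)"
proof -
  interpret connected_network G by unfold_locales (rule assms)+
  interpret kuramoto_network G \<gamma> \<omega> I vs
    using assms by unfold_locales (auto simp: arcs_conv)
  obtain \<Phi> where \<Phi>: "bij_betw \<Phi> \<Theta> {\<alpha> \<in> A. W \<alpha> \<in> Z}"
    using ex_bij_betw_states_lattice_parameters
    unfolding states_def lattice_parameters_def A_def W_def Z_def \<Theta>_def by blast
  \<comment> \<open>The image of the lattice parameters under \<open>W\<close> consists of all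
    lattice points of its range on \<open>A\<close>, so injectivity is all that a bijection still
    requires.\<close>
  have "bij_betw (W \<circ> \<Phi>) \<Theta> (W ` A \<inter> Z)" if "inj_on W {\<alpha> \<in> A. W \<alpha> \<in> Z}"
    by (rule bij_betw_trans[OF \<Phi>]) (use that in \<open>auto simp: bij_betw_def\<close>)
  then show ?thesis
    using \<Phi> relative_fixed_points_eq_fixed_points[of \<omega> \<gamma>] unfolding \<Theta>_def by auto
qed

end
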